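(* Let $\mathcal H$ be a Hilbert space with $\dim\mathcal H=n$, let $\mathcal W=\{W_i\}_{i=1}^m$ be subspaces spanning $\mathcal H$ with $\dim W_i=d_i\ge1$, let $w_i=d_i^{-1/2}$, $\mathcal W_w=(w_i,W_i)_{i=1}^m$, and let $B=B_{\mathcal W_w}$. Let $$\mathcal S(\mathcal W_w)=\operatorname*{arg\,min}_{z\in\Delta}\langle Bz,z\rangle,\qquad J(\mathcal W_w)=\big\{J\subseteq\{1,\dots,m\}:J=\operatorname{supp}\{z\}\text{ for some }z\in\mathcal S(\mathcal W_w)\big\}.$$ Then: 1. The set $\mathcal S(\mathcal W_w)$ is convex. Moreover, for any $z_0\in\mathcal S(\mathcal W_w)$, $\mathcal S(\mathcal W_w)=(z_0+N(B))\cap\Delta$. 2. $J(\mathcal W_w)$ is closed under taking unions, so that $J_{\mathcal W_w}=\bigcup J(\mathcal W_w)=\bigcup_{z\in\mathcal S(\mathcal W_w)}\operatorname{supp}\{z\}$ is an element of $J(\mathcal W_w)$, and there exists $z_1\in\mathcal S(\mathcal W_w)$ with maximal support.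
   Context: $P_W$ is the orthogonal projection onto $W$. $B_{\mathcal W_w}\in\mathcal M_m(\mathbb R)$ is the positive semidefinite matrix with entries $w_i^2w_j^2\operatorname{tr}(P_{W_i}P_{W_j})$, and $N(B)\subseteq\mathbb R^m$ is its null space. $\Delta=\{x\in\mathbb R^m:\sum_i x_i=1,\ x_i\ge0\text{ for all }i\}$ is the compact convex simplex. For $z\in\mathbb R^m$, $\operatorname{supp}\{z\}=\{j:z_j\ne0\}$. *)

theory Defs
  imports "HOL-Analysis.Analysis"
begin

text \<open>The scalars of a Hilbert space: up to isomorphism, the reals and the complexes. Each \<open>x\<close> is a root
  of the real polynomial \<open>X^2 - 2 (real_part x) X + (norm x)^2\<close>, so that no other field qualifies,
  and \<open>conjg_mult_self\<close> then forces \<open>conjg\<close> to be the identity or complex conjugation.\<close>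

class rc_field = real_normed_field +
  fixes conjg :: "'a \<Rightarrow> 'a" and real_part :: "'a \<Rightarrow> real"
  assumes conjg_add: "conjg (x + y) = conjg x + conjg y"
    and conjg_mult: "conjg (x * y) = conjg x * conjg y"
    and conjg_mult_self: "x * conjg x = (norm x)\<^sup>2 *\<^sub>R 1"
    and add_conjg_self: "x + conjg x = (2 * real_part x) *\<^sub>R 1"

instantiation real :: rc_field
begin
definition conjg_real :: "real \<Rightarrow> real" where "conjg_real x = x"
definition real_part_real :: "real \<Rightarrow> real" where "real_part_real x = x"
instance
  by standard (simp_all add: conjg_real_def real_part_real_def power2_eq_square)
end

instantiation complex :: rc_field
begin
definition conjg_complex :: "complex \<Rightarrow> complex" where "conjg_complex x = cnj x"
definition real_part_complex :: "complex \<Rightarrow> real" where "real_part_complex x = Re x"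
instance
  by standard
    (simp_all only: conjg_complex_def real_part_complex_def complex_cnj_add complex_cnj_mult
      complex_norm_square[symmetric] complex_add_cnj of_real_def[symmetric])
end

text \<open>Finite-dimensional Hilbert spaces; completeness is automatic. The parameter \<open>bs\<close> is an
  arbitrary linear basis (not assumed orthonormal) witnessing finite dimension.\<close>

locale fin_dim_hilbert_space = finite_dimensional_vector_space smul bs
  for smul :: "'k::rc_field \<Rightarrow> 'h::ab_group_add \<Rightarrow> 'h" and bs :: "'h set" +
  fixes ip :: "'h \<Rightarrow> 'h \<Rightarrow> 'k"
  assumes ip_add_left: "ip (x + y) z = ip x z + ip y z"
    and ip_scale_left: "ip (smul c x) y = c * ip x y"
    and ip_conj_sym: "ip y x = conjg (ip x y)"
    and ip_pos: "x \<noteq> 0 \<Longrightarrow> \<exists>r>0. ip x x = of_real r"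

definition orth_proj :: "('h::ab_group_add \<Rightarrow> 'h \<Rightarrow> 'k::rc_field) \<Rightarrow> 'h set \<Rightarrow> 'h \<Rightarrow> 'h" where
  "orth_proj ip W x = (THE y. y \<in> W \<and> (\<forall>z\<in>W. ip (x - y) z = 0))"

text \<open>The trace of the linear operator \<open>f\<close>, as the sum of the diagonal entries of its matrix in the
  basis \<open>bs\<close>; the value does not depend on the basis.\<close>

definition op_trace ::
  "('k::rc_field \<Rightarrow> 'h::ab_group_add \<Rightarrow> 'h) \<Rightarrow> 'h set \<Rightarrow> ('h \<Rightarrow> 'h) \<Rightarrow> 'k" where
  "op_trace smul bs f = (\<Sum>b\<in>bs. module.representation smul bs (f b) b)"

text \<open>The trace of a product of two orthogonal projections is a real number, so that
  \<open>real_part\<close> below only changes its type.\<close>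

definition fusion_matrix ::
  "('k::rc_field \<Rightarrow> 'h::ab_group_add \<Rightarrow> 'h) \<Rightarrow> 'h set \<Rightarrow> ('h \<Rightarrow> 'h \<Rightarrow> 'k)
    \<Rightarrow> ('m::finite \<Rightarrow> real) \<Rightarrow> ('m \<Rightarrow> 'h set) \<Rightarrow> real^'m^'m" where
  "fusion_matrix smul bs ip w W =
    (\<chi> i j. (w i)\<^sup>2 * (w j)\<^sup>2 *
      real_part (op_trace smul bs (orth_proj ip (W i) \<circ> orth_proj ip (W j))))"

definition null_space :: "real^'m^'m \<Rightarrow> (real^'m::finite) set" where
  "null_space B = {x. B *v x = 0}"

definition std_simplex :: "(real^'m::finite) set" where
  "std_simplex = {x. (\<Sum>i\<in>UNIV. x $ i) = 1 \<and> (\<forall>i. x $ i \<ge> 0)}"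

definition supp :: "real^'m::finite \<Rightarrow> 'm set" where
  "supp z = {j. z $ j \<noteq> 0}"

definition min_set :: "real^'m^'m \<Rightarrow> (real^'m::finite) set" where
  "min_set B = {z. is_arg_min (\<lambda>z. (B *v z) \<bullet> z) (\<lambda>z. z \<in> std_simplex) z}"

definition supp_sets :: "real^'m^'m \<Rightarrow> 'm::finite set set" where
  "supp_sets B = {J. \<exists>z\<in>min_set B. J = supp z}"

end

theory Submission
  imports Defs
begin

text \<open>Write \<open>q z = (B *v z) \<bullet> z\<close>. The whole statement is a consequence of \<open>B\<close> being symmetric and
  positive semidefinite. It is so because it is a sum of Gram matrices: with a finite family \<open>E\<close>
  satisfying \<open>x = (\<Sum>g\<in>E. \<langle>x, g\<rangle> g)\<close> for all \<open>x\<close> (an orthonormal basis, obtained by Gram--Schmidt),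
  the trace of a linear map \<open>f\<close> is \<open>\<Sum>g\<in>E. \<langle>f g, g\<rangle>\<close>, and as orthogonal projections are self-adjoint,
  the trace of \<open>P\<^sub>i P\<^sub>j\<close> is \<open>\<Sum>g\<in>E. \<langle>P\<^sub>j g, P\<^sub>i g\<rangle>\<close> (lemma \<open>trace_orth_proj_comp\<close>).

  Now let \<open>z\<^sub>0\<close> be a minimiser of \<open>q\<close> on the simplex, which exists by compactness. If \<open>z\<close> is another one,
  the parallelogram identity at the midpoint gives \<open>q (z - z\<^sub>0) \<le> 0\<close>, hence \<open>q (z - z\<^sub>0) = 0\<close>, and
  for a positive semidefinite form this means \<open>B (z - z\<^sub>0) = 0\<close>. Conversely, adding to \<open>z\<^sub>0\<close> a vector
  of the null space does not change \<open>q\<close>. So the minimisers are the points of the simplex in the affine subspace \<open>z\<^sub>0 + N(B)\<close>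
  (lemma \<open>min_set_eq_affine_Int_simplex\<close>), a convex set. Since points of the simplex have nonnegative
  coordinates, the support of the midpoint of two minimisers is the union of their supports; there
  being finitely many supports, closure under arbitrary nonempty unions follows by induction.\<close>

section \<open>Conjugation and real part on the scalars\<close>

lemma conjg_of_real [simp]: "conjg (of_real r :: 'k::rc_field) = of_real r"
proof (cases "r = 0")
  case True
  have "conjg (0::'k) + conjg 0 = conjg 0"
    by (metis conjg_add add_0)
  then show ?thesis using True by simp
next
  case False
  have "(of_real r :: 'k) * conjg (of_real r) = of_real r * of_real r"
    using conjg_mult_self[of "of_real r :: 'k"]
    by (simp add: scaleR_conv_of_real power2_eq_square)
  then show ?thesis using False by simp
qed

lemma conjg_0 [simp]: "conjg (0::'k::rc_field) = 0"
  using conjg_of_real[of 0] by simp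

lemma conjg_conjg [simp]: "conjg (conjg (x::'k::rc_field)) = x"
proof -
  have "conjg (x + conjg x) = x + conjg x"
    by (metis add_conjg_self of_real_def conjg_of_real)
  then show ?thesis by (simp add: conjg_add add.commute)
qed

lemma of_real_real_part: "of_real (2 * real_part x) = x + conjg (x::'k::rc_field)"
  by (simp only: add_conjg_self of_real_def)

lemma real_part_eqI:
  assumes "x + conjg x = of_real (2 * r)"
  shows "real_part (x::'k::rc_field) = r"
  using assms of_real_real_part[of x] by (metis of_real_eq_iff mult_cancel_left zero_neq_numeral)

lemma real_part_of_real [simp]: "real_part (of_real r :: 'k::rc_field) = r"
  by (rule real_part_eqI) simp

lemma real_part_add: "real_part (x + y) = real_part x + real_part (y::'k::rc_field)"
proof (rule real_part_eqI)
  have "x + y + conjg (x + y) = (x + conjg x) + (y + conjg y)"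
    by (simp add: conjg_add algebra_simps)
  also have "\<dots> = of_real (2 * (real_part x + real_part y))"
    by (simp only: of_real_real_part[symmetric] of_real_add[symmetric] distrib_left)
  finally show "x + y + conjg (x + y) = of_real (2 * (real_part x + real_part y))" .
qed

lemma real_part_0 [simp]: "real_part (0::'k::rc_field) = 0"
  using real_part_of_real[of 0, where ?'k = 'k] by simp

lemma real_part_sum: "real_part (sum f A) = (\<Sum>i\<in>A. real_part (f i :: 'k::rc_field))"
  by (induction A rule: infinite_finite_induct) (simp_all add: real_part_add)

lemma real_part_of_real_mult: "real_part (of_real r * x) = r * real_part (x::'k::rc_field)"
proof (rule real_part_eqI)
  have "of_real r * x + conjg (of_real r * x) = of_real r * (x + conjg x)"
    by (simp add: conjg_mult distrib_left)
  also have "\<dots> = of_real (2 * (r * real_part x))"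
    by (simp only: of_real_real_part[symmetric] of_real_mult[symmetric] mult.left_commute)
  finally show "of_real r * x + conjg (of_real r * x) = of_real (2 * (r * real_part x))" .
qed

lemma real_part_conjg [simp]: "real_part (conjg x) = real_part (x::'k::rc_field)"
  by (rule real_part_eqI) (simp add: of_real_real_part[symmetric] add.commute del: of_real_mult)

section \<open>Orthogonal projections and traces\<close>

context fin_dim_hilbert_space
begin

lemma ip_add_right: "ip z (x + y) = ip z x + ip z y"
  by (metis ip_conj_sym ip_add_left conjg_add)

lemma ip_scale_right: "ip x (smul c y) = conjg c * ip x y"
  by (metis ip_conj_sym ip_scale_left conjg_mult)

lemma ip_0_left [simp]: "ip 0 z = 0"
  using ip_add_left[of 0 0 z] by simp

lemma ip_0_right [simp]: "ip z 0 = 0"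
  using ip_add_right[of z 0 0] by simp

lemma ip_diff_left: "ip (x - y) z = ip x z - ip y z"
  using ip_add_left[of "x - y" y z] by simp

lemma ip_diff_right: "ip z (x - y) = ip z x - ip z y"
  using ip_add_right[of z "x - y" y] by simp

lemma ip_sum_left: "ip (sum f A) z = (\<Sum>i\<in>A. ip (f i) z)"
  by (induction A rule: infinite_finite_induct) (simp_all add: ip_add_left)

lemma ip_sum_right: "ip z (sum f A) = (\<Sum>i\<in>A. ip z (f i))"
  by (induction A rule: infinite_finite_induct) (simp_all add: ip_add_right)

lemma ip_self_eq_0_iff: "ip x x = 0 \<longleftrightarrow> x = 0"
  using ip_pos[of x] by force

lemma real_part_ip_self_nonneg: "real_part (ip x x) \<ge> 0"
proof (cases "x = 0")
  case False
  then show ?thesis using ip_pos[of x] by auto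
qed simp

lemma real_part_ip_commute: "real_part (ip y x) = real_part (ip x y)"
  by (metis ip_conj_sym real_part_conjg)

text \<open>A finite family \<open>E\<close> in \<open>V\<close> that reproduces the vectors of \<open>V\<close> as an orthonormal basis would.
  Orthonormality itself is never needed below, and is not recorded.\<close>

definition reproducing :: "'h set \<Rightarrow> 'h set \<Rightarrow> bool" where
  "reproducing E V \<longleftrightarrow> finite E \<and> E \<subseteq> V \<and> (\<forall>x\<in>V. x = (\<Sum>e\<in>E. smul (ip x e) e))"

text \<open>For any \<open>x\<close>, in \<open>V\<close> or not, the sum \<open>\<Sum>e\<in>E. \<langle>x, e\<rangle> e\<close> is the orthogonal projection of \<open>x\<close> onto
  \<open>V\<close>.\<close>

lemma reproducing_residual_orthogonal:
  assumes "reproducing E V" and "z \<in> V"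
  shows "ip (x - (\<Sum>e\<in>E. smul (ip x e) e)) z = 0"
proof -
  have z: "z = (\<Sum>e\<in>E. smul (ip z e) e)"
    using assms by (auto simp: reproducing_def)
  have "ip x z = ip x (\<Sum>e\<in>E. smul (ip z e) e)"
    using z by simp
  also have "\<dots> = (\<Sum>e\<in>E. ip x e * ip e z)"
    by (simp add: ip_sum_right ip_scale_right ip_conj_sym[of z] mult.commute)
  finally show ?thesis
    by (simp add: ip_diff_left ip_sum_left ip_scale_left)
qed

text \<open>The Gram--Schmidt step: the residual of the new vector is normalised and added to the family.\<close>

lemma exists_reproducing_span:
  assumes "finite S"
  shows "\<exists>E. reproducing E (span S)"
  using assms
proof (induction S rule: finite_induct)
  case empty
  have "reproducing {} (span {})" by (simp add: reproducing_def)
  then show ?case by blast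
next
  case (insert b S)
  then obtain E where E: "reproducing E (span S)" by blast
  then have finE: "finite E" and Esub: "E \<subseteq> span S"
    and exp: "\<And>x. x \<in> span S \<Longrightarrow> (\<Sum>e\<in>E. smul (ip x e) e) = x"
    by (auto simp: reproducing_def)
  define p where "p = (\<Sum>e\<in>E. smul (ip b e) e)"
  define u where "u = b - p"
  have p_in: "p \<in> span S"
    unfolding p_def using Esub by (intro span_sum span_scale) auto
  have u_orth: "ip u z = 0" if "z \<in> span S" for z
    unfolding u_def p_def by (rule reproducing_residual_orthogonal[OF E that])
  have decomp: "\<exists>k s. s \<in> span S \<and> x = smul k u + s" if "x \<in> span (insert b S)" for x
  proof -
    obtain k where k: "x - smul k b \<in> span S"
      using \<open>x \<in> span (insert b S)\<close> by (auto simp: span_insert)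
    have "x = smul k u + ((x - smul k b) + smul k p)"
      by (simp add: u_def scale_right_diff_distrib)
    moreover have "(x - smul k b) + smul k p \<in> span S"
      using k p_in by (intro span_add span_scale)
    ultimately show ?thesis by blast
  qed
  have mono: "span S \<subseteq> span (insert b S)"
    by (intro span_mono) auto
  show ?case
  proof (cases "u = 0")
    case True
    have "reproducing E (span (insert b S))"
      unfolding reproducing_def
    proof (intro conjI ballI finE)
      show "E \<subseteq> span (insert b S)" using Esub mono by blast
      fix x assume "x \<in> span (insert b S)"
      then have "x \<in> span S" using decomp[of x] True by auto
      then show "x = (\<Sum>e\<in>E. smul (ip x e) e)" by (simp add: exp)
    qed
    then show ?thesis by blast
  next
    case False
    then obtain r where r: "r > 0" "ip u u = of_real r" using ip_pos by blast
    define v where "v = smul (of_real (1 / sqrt r)) u"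
    have v_orth: "ip v z = 0" if "z \<in> span S" for z
      by (simp add: v_def ip_scale_left u_orth that)
    have orth_u: "ip z u = 0" if "z \<in> span S" for z
      using u_orth[OF that] ip_conj_sym[of z u] by simp
    have v_nonzero: "v \<noteq> 0" using r False by (simp add: v_def)
    have v_notin: "v \<notin> E"
      using v_orth[of v] v_nonzero Esub ip_self_eq_0_iff[of v] by auto
    have scale_r: "of_real (1 / sqrt r) * (of_real (1 / sqrt r) * of_real r) = (1 :: 'k)"
    proof -
      have "1 / sqrt r * (1 / sqrt r * r) = 1"
        using r(1) by (simp add: field_simps)
      then show ?thesis by (metis of_real_mult of_real_1)
    qed
    have "reproducing (insert v E) (span (insert b S))"
      unfolding reproducing_def
    proof (intro conjI ballI)
      show "finite (insert v E)" using finE by simp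
      have "u \<in> span (insert b S)"
        unfolding u_def using p_in mono by (intro span_diff) (auto intro: span_base)
      then have "v \<in> span (insert b S)"
        unfolding v_def by (rule span_scale)
      then show "insert v E \<subseteq> span (insert b S)" using Esub mono by blast
      fix x assume "x \<in> span (insert b S)"
      then obtain k s where s: "s \<in> span S" and x: "x = smul k u + s"
        using decomp by blast
      have "ip x v = k * (of_real (1 / sqrt r) * of_real r)"
        by (simp only: x ip_add_left ip_scale_left orth_u[OF s] v_def ip_scale_right
            conjg_of_real r(2)) simp
      then have "smul (ip x v) v = smul (k * (of_real (1 / sqrt r) * (of_real (1 / sqrt r) * of_real r))) u"
        by (simp add: v_def mult_ac)
      also have "\<dots> = smul k u" by (simp only: scale_r mult_1_right)
      finally have 1: "smul (ip x v) v = smul k u" .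
      have "ip x e = ip s e" if "e \<in> E" for e
        using that Esub by (auto simp: x ip_add_left ip_scale_left u_orth)
      then have "(\<Sum>e\<in>E. smul (ip x e) e) = s"
        using exp[OF s] by simp
      then show "x = (\<Sum>e\<in>insert v E. smul (ip x e) e)"
        using finE v_notin 1 x by simp
    qed
    then show ?thesis by blast
  qed
qed

lemma exists_reproducing:
  assumes "subspace V"
  shows "\<exists>E. reproducing E V"
proof -
  obtain S where S: "S \<subseteq> V" "independent S" "V \<subseteq> span S"
    by (meson basis_exists)
  have "span S = V"
    using S span_minimal[OF S(1) assms] by blast
  with exists_reproducing_span[OF finiteI_independent[OF S(2)]] show ?thesis by simp
qed

lemma orth_proj_unique_existence:
  assumes "subspace V"
  shows "\<exists>!y. y \<in> V \<and> (\<forall>z\<in>V. ip (x - y) z = 0)"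
proof (rule ex_ex1I)
  obtain E where E: "reproducing E V" using exists_reproducing[OF assms] by blast
  have "(\<Sum>e\<in>E. smul (ip x e) e) \<in> V"
    using E assms by (intro subspace_sum subspace_scale) (auto simp: reproducing_def)
  with reproducing_residual_orthogonal[OF E]
  show "\<exists>y. y \<in> V \<and> (\<forall>z\<in>V. ip (x - y) z = 0)" by blast
next
  fix y y'
  assume y: "y \<in> V \<and> (\<forall>z\<in>V. ip (x - y) z = 0)" and y': "y' \<in> V \<and> (\<forall>z\<in>V. ip (x - y') z = 0)"
  then have "y - y' \<in> V" using assms subspace_diff by blast
  then have "ip (x - y') (y - y') - ip (x - y) (y - y') = 0" using y y' by simp
  then have "ip (y - y') (y - y') = 0" by (simp add: ip_diff_left)
  then show "y = y'" by (simp add: ip_self_eq_0_iff)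
qed

lemma orth_proj_in:
  assumes "subspace V"
  shows "orth_proj ip V x \<in> V"
  using theI'[OF orth_proj_unique_existence[OF assms]] unfolding orth_proj_def by blast

lemma orth_proj_orthogonal:
  assumes "subspace V" and "z \<in> V"
  shows "ip (x - orth_proj ip V x) z = 0"
  using theI'[OF orth_proj_unique_existence[OF assms(1)]] assms(2) unfolding orth_proj_def by blast

lemma orth_proj_eqI:
  assumes "subspace V" and "y \<in> V" and "\<And>z. z \<in> V \<Longrightarrow> ip (x - y) z = 0"
  shows "orth_proj ip V x = y"
  using orth_proj_unique_existence[OF assms(1), of x] assms orth_proj_in orth_proj_orthogonal
  by blast

lemma orth_proj_add:
  assumes "subspace V"
  shows "orth_proj ip V (x + y) = orth_proj ip V x + orth_proj ip V y"
proof (rule orth_proj_eqI[OF assms])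
  show "orth_proj ip V x + orth_proj ip V y \<in> V"
    using assms by (intro subspace_add orth_proj_in)
  show "ip (x + y - (orth_proj ip V x + orth_proj ip V y)) z = 0" if "z \<in> V" for z
    using orth_proj_orthogonal[OF assms that, of x] orth_proj_orthogonal[OF assms that, of y]
    by (simp add: ip_diff_left ip_add_left)
qed

lemma orth_proj_scale:
  assumes "subspace V"
  shows "orth_proj ip V (smul c x) = smul c (orth_proj ip V x)"
proof (rule orth_proj_eqI[OF assms])
  show "smul c (orth_proj ip V x) \<in> V"
    using assms by (intro subspace_scale orth_proj_in)
  show "ip (smul c x - smul c (orth_proj ip V x)) z = 0" if "z \<in> V" for z
    using orth_proj_orthogonal[OF assms that, of x]
    by (simp add: ip_diff_left ip_scale_left)
qed

lemma orth_proj_self_adjoint: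
  assumes "subspace V"
  shows "ip (orth_proj ip V x) y = ip x (orth_proj ip V y)"
proof -
  let ?P = "orth_proj ip V"
  have "ip (y - ?P y) (?P x) = 0"
    using assms by (intro orth_proj_orthogonal orth_proj_in)
  then have "ip (?P x) (y - ?P y) = 0"
    using ip_conj_sym[of "?P x" "y - ?P y"] by simp
  then have "ip (?P x) y = ip (?P x) (?P y)" by (simp add: ip_diff_right)
  moreover have "ip (x - ?P x) (?P y) = 0"
    using assms by (intro orth_proj_orthogonal orth_proj_in)
  ultimately show ?thesis by (simp add: ip_diff_left)
qed

text \<open>Expand each \<open>b\<close> of the basis \<open>bs\<close> in \<open>E\<close> and exchange the sums: if \<open>(f g)\<^sub>b\<close> are the coordinates of
  \<open>f g\<close> in \<open>bs\<close>, then \<open>\<Sum>b\<in>bs. \<langle>b, g\<rangle> (f g)\<^sub>b\<close> is \<open>\<langle>f g, g\<rangle>\<close>.\<close>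

lemma op_trace_eq_sum_reproducing:
  assumes E: "reproducing E UNIV"
    and add: "\<And>x y. f (x + y) = f x + f y" and scale: "\<And>c x. f (smul c x) = smul c (f x)"
  shows "op_trace smul bs f = (\<Sum>g\<in>E. ip (f g) g)"
proof -
  have "f 0 = 0" using scale[of 0 0] by simp
  then have f_sum: "f (sum h A) = (\<Sum>i\<in>A. f (h i))" for h :: "'h \<Rightarrow> 'h" and A
    by (induction A rule: infinite_finite_induct) (simp_all add: add)
  have rep_f: "representation bs (f b) c = (\<Sum>g\<in>E. ip b g * representation bs (f g) c)" for b c
  proof -
    have "b = (\<Sum>g\<in>E. smul (ip b g) g)" using E by (simp add: reproducing_def)
    then have "f b = (\<Sum>g\<in>E. smul (ip b g) (f g))" by (metis (no_types, lifting) f_sum scale sum.cong)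
    then show ?thesis
      by (simp add: representation_sum representation_scale independent_Basis span_Basis)
  qed
  have "op_trace smul bs f = (\<Sum>b\<in>bs. \<Sum>g\<in>E. ip b g * representation bs (f g) b)"
    unfolding op_trace_def by (intro sum.cong refl rep_f)
  also have "\<dots> = (\<Sum>g\<in>E. \<Sum>b\<in>bs. ip b g * representation bs (f g) b)"
    by (rule sum.swap)
  also have "\<dots> = (\<Sum>g\<in>E. ip (\<Sum>b\<in>bs. smul (representation bs (f g) b) b) g)"
    by (simp add: ip_sum_left ip_scale_left mult.commute)
  also have "\<dots> = (\<Sum>g\<in>E. ip (f g) g)"
    by (simp add: sum_representation_eq independent_Basis span_Basis finite_Basis)
  finally show ?thesis .
qed

lemma trace_orth_proj_comp:
  assumes E: "reproducing E UNIV" and U: "subspace U" and V: "subspace V"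
  shows "op_trace smul bs (orth_proj ip U \<circ> orth_proj ip V)
    = (\<Sum>g\<in>E. ip (orth_proj ip V g) (orth_proj ip U g))"
  using op_trace_eq_sum_reproducing[OF E, of "orth_proj ip U \<circ> orth_proj ip V"]
  by (simp add: orth_proj_add orth_proj_scale orth_proj_self_adjoint[OF U] U V)

text \<open>For each \<open>g\<close>, the summand is an entry of the Gram matrix of the vectors \<open>w\<^sub>i\<^sup>2 P\<^sub>i g\<close>.\<close>

lemma fusion_matrix_sum_Gram:
  assumes "reproducing E UNIV" and "\<And>i. subspace (W i)"
  shows "fusion_matrix smul bs ip w W $ i $ j = (\<Sum>g\<in>E. real_part
    (ip (smul (of_real ((w j)\<^sup>2)) (orth_proj ip (W j) g)) (smul (of_real ((w i)\<^sup>2)) (orth_proj ip (W i) g))))"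
  by (simp add: fusion_matrix_def trace_orth_proj_comp[OF assms(1,2,2)] real_part_sum ip_scale_left
      ip_scale_right real_part_of_real_mult sum_distrib_left mult_ac
      del: of_real_power of_real_mult)

lemma fusion_matrix_symmetric:
  assumes "\<And>i. subspace (W i)"
  shows "transpose (fusion_matrix smul bs ip w W) = fusion_matrix smul bs ip w W"
proof -
  obtain E where E: "reproducing E UNIV" using exists_reproducing[of UNIV] by auto
  show ?thesis
    by (simp add: vec_eq_iff transpose_def fusion_matrix_sum_Gram[OF E assms])
      (intro allI sum.cong refl real_part_ip_commute)
qed

lemma fusion_matrix_psd:
  assumes "\<And>i. subspace (W i)"
  shows "(fusion_matrix smul bs ip w W *v x) \<bullet> x \<ge> 0"
proof -
  obtain E where E: "reproducing E UNIV" using exists_reproducing[of UNIV] by auto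
  define v where "v i g = smul (of_real ((w i)\<^sup>2)) (orth_proj ip (W i) g)" for i g
  define T where "T g = (\<Sum>i\<in>UNIV. smul (of_real (x $ i)) (v i g))" for g
  have "(fusion_matrix smul bs ip w W *v x) \<bullet> x
      = (\<Sum>i\<in>UNIV. \<Sum>j\<in>UNIV. \<Sum>g\<in>E. x $ i * (x $ j * real_part (ip (v j g) (v i g))))"
    by (simp add: inner_vec_def matrix_vector_mult_def fusion_matrix_sum_Gram[OF E assms]
        v_def sum_distrib_left sum_distrib_right mult_ac)
  also have "\<dots> = (\<Sum>i\<in>UNIV. \<Sum>g\<in>E. \<Sum>j\<in>UNIV. x $ i * (x $ j * real_part (ip (v j g) (v i g))))"
    by (intro sum.cong refl sum.swap)
  also have "\<dots> = (\<Sum>g\<in>E. \<Sum>i\<in>UNIV. \<Sum>j\<in>UNIV. x $ i * (x $ j * real_part (ip (v j g) (v i g))))"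
    by (rule sum.swap)
  also have "\<dots> = (\<Sum>g\<in>E. real_part (ip (T g) (T g)))"
    by (simp add: T_def ip_sum_left ip_sum_right ip_scale_left ip_scale_right real_part_sum
        real_part_of_real_mult sum_distrib_left)
  also have "\<dots> \<ge> 0"
    by (intro sum_nonneg real_part_ip_self_nonneg)
  finally show ?thesis .
qed

end

section \<open>Minimising a positive semidefinite form on the simplex\<close>

lemma symmetric_matrix_inner_commute:
  fixes B :: "real^'m^'m"
  assumes "transpose B = B"
  shows "(B *v x) \<bullet> y = (B *v y) \<bullet> x"
  by (metis assms dot_lmul_matrix inner_commute transpose_matrix_vector)

text \<open>If \<open>q y = 0\<close>, then \<open>q (y + t B y) = 2 t |B y|\<^sup>2 + O(t\<^sup>2)\<close>, which is negative for suitable small \<open>t < 0\<close>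
  unless \<open>B y = 0\<close>.\<close>

lemma psd_form_zero_imp_null:
  fixes B :: "real^'m^'m"
  assumes sym: "transpose B = B" and psd: "\<And>x. (B *v x) \<bullet> x \<ge> 0" and zero: "(B *v y) \<bullet> y = 0"
  shows "B *v y = 0"
proof (rule ccontr)
  assume ne: "B *v y \<noteq> 0"
  define a where "a = (B *v y) \<bullet> (B *v y)"
  define c where "c = (B *v (B *v y)) \<bullet> (B *v y)"
  have a: "a > 0" using ne by (simp add: a_def)
  have c: "c \<ge> 0" using psd by (simp add: c_def)
  have expand: "(B *v (y + t *\<^sub>R (B *v y))) \<bullet> (y + t *\<^sub>R (B *v y)) = 2 * t * a + t * t * c" for t
    using zero symmetric_matrix_inner_commute[OF sym, of "B *v y" y]
    by (simp add: matrix_vector_right_distrib matrix_vector_mult_scaleR inner_add_left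
        inner_add_right a_def c_def algebra_simps)
  \<comment> \<open>For \<open>c > 0\<close> the minimum over \<open>t\<close> is at \<open>- a / c\<close>; the \<open>+ 1\<close> covers \<open>c = 0\<close>.\<close>
  define t where "t = - a / (c + 1)"
  have "t < 0" using a c by (simp add: t_def divide_neg_pos)
  have "t * c + 2 * a > 0"
  proof -
    have "a * c / (c + 1) \<le> a" using a c by (simp add: field_simps)
    then show ?thesis using a by (simp add: t_def)
  qed
  then have "t * (t * c + 2 * a) < 0" using \<open>t < 0\<close> by (simp add: mult_neg_pos)
  moreover have "t * (t * c + 2 * a) \<ge> 0"
    using psd[of "y + t *\<^sub>R (B *v y)"] unfolding expand by (simp add: algebra_simps)
  ultimately show False by simp
qed

lemma convex_std_simplex: "convex (std_simplex :: (real^'m::finite) set)"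
  unfolding convex_def std_simplex_def
  by (auto simp: sum.distrib sum_distrib_left[symmetric])

lemma compact_std_simplex: "compact (std_simplex :: (real^'m::finite) set)"
proof -
  have "closed (std_simplex :: (real^'m) set)"
    unfolding std_simplex_def
    by (intro closed_Collect_conj closed_Collect_all closed_Collect_eq closed_Collect_le
        continuous_intros)
  moreover have "norm x \<le> 1" if "x \<in> std_simplex" for x :: "real^'m"
    using norm_le_l1_cart[of x] that by (simp add: std_simplex_def)
  then have "bounded (std_simplex :: (real^'m) set)"
    unfolding bounded_iff by blast
  ultimately show ?thesis by (simp add: compact_eq_bounded_closed)
qed

lemma std_simplex_nonempty: "(std_simplex :: (real^'m::finite) set) \<noteq> {}"
proof -
  obtain k :: 'm where True by simp
  have "axis k 1 \<in> (std_simplex :: (real^'m) set)"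
    by (simp add: std_simplex_def axis_def sum.delta')
  then show ?thesis by blast
qed

lemma mem_min_set_iff:
  "z \<in> min_set B \<longleftrightarrow> z \<in> std_simplex \<and> (\<forall>y\<in>std_simplex. (B *v z) \<bullet> z \<le> (B *v y) \<bullet> y)"
  unfolding min_set_def is_arg_min_def by (auto simp: not_less)

lemma min_set_nonempty: "min_set B \<noteq> {}"
proof -
  have "continuous_on std_simplex (\<lambda>z. (B *v z) \<bullet> z)"
    by (intro continuous_intros matrix_vector_mult_linear_continuous_on)
  from continuous_attains_inf[OF compact_std_simplex std_simplex_nonempty this]
  show ?thesis using mem_min_set_iff by blast
qed

lemma min_set_eq_affine_Int_simplex:
  fixes B :: "real^'m^'m"
  assumes sym: "transpose B = B" and psd: "\<And>x. (B *v x) \<bullet> x \<ge> 0" and z0: "z\<^sub>0 \<in> min_set B"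
  shows "min_set B = {z\<^sub>0 + y | y. y \<in> null_space B} \<inter> std_simplex"
proof (intro equalityI subsetI)
  fix z assume z: "z \<in> min_set B"
  define h where "h = (1/2) *\<^sub>R z\<^sub>0 + (1/2) *\<^sub>R z"
  have q_eq: "(B *v z) \<bullet> z = (B *v z\<^sub>0) \<bullet> z\<^sub>0"
    using z z0 unfolding mem_min_set_iff by (meson order.antisym)
  have "h \<in> std_simplex"
    unfolding h_def using z z0 by (intro convexD[OF convex_std_simplex]) (auto simp: mem_min_set_iff)
  then have "(B *v z\<^sub>0) \<bullet> z\<^sub>0 \<le> (B *v h) \<bullet> h"
    using z0 unfolding mem_min_set_iff by blast
  moreover have "4 * ((B *v h) \<bullet> h) = 2 * ((B *v z\<^sub>0) \<bullet> z\<^sub>0) + 2 * ((B *v z) \<bullet> z) - (B *v (z - z\<^sub>0)) \<bullet> (z - z\<^sub>0)"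
    by (simp add: h_def matrix_vector_right_distrib matrix_vector_mult_scaleR
        matrix_vector_mult_diff_distrib inner_add_left inner_add_right inner_diff_left
        inner_diff_right algebra_simps)
  ultimately have "(B *v (z - z\<^sub>0)) \<bullet> (z - z\<^sub>0) = 0"
    using q_eq psd[of "z - z\<^sub>0"] by linarith
  then have "z - z\<^sub>0 \<in> null_space B"
    unfolding null_space_def using psd_form_zero_imp_null[OF sym psd] by simp
  moreover have "z = z\<^sub>0 + (z - z\<^sub>0)" by simp
  ultimately show "z \<in> {z\<^sub>0 + y | y. y \<in> null_space B} \<inter> std_simplex"
    using z unfolding mem_min_set_iff by blast
next
  fix z assume "z \<in> {z\<^sub>0 + y | y. y \<in> null_space B} \<inter> std_simplex"
  then obtain y where y: "B *v y = 0" "z = z\<^sub>0 + y" and z: "z \<in> std_simplex"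
    unfolding null_space_def by auto
  have "(B *v z) \<bullet> z = (B *v z\<^sub>0) \<bullet> z\<^sub>0"
    using y symmetric_matrix_inner_commute[OF sym, of z\<^sub>0 y]
    by (simp add: matrix_vector_right_distrib inner_add_right)
  then show "z \<in> min_set B" using z z0 unfolding mem_min_set_iff by simp
qed

lemma convex_null_space: "convex (null_space B)"
  unfolding convex_def null_space_def
  by (simp add: matrix_vector_right_distrib matrix_vector_mult_scaleR)

lemma convex_min_set:
  fixes B :: "real^'m^'m"
  assumes "transpose B = B" and "\<And>x. (B *v x) \<bullet> x \<ge> 0"
  shows "convex (min_set B)"
proof -
  obtain z\<^sub>0 where z0: "z\<^sub>0 \<in> min_set B" using min_set_nonempty by blast
  have "{z\<^sub>0 + y | y. y \<in> null_space B} = (+) z\<^sub>0 ` null_space B" by blast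
  then show ?thesis
    unfolding min_set_eq_affine_Int_simplex[OF assms z0]
    by (metis convex_Int convex_std_simplex convex_translation convex_null_space)
qed

lemma supp_midpoint:
  assumes "x \<in> std_simplex" and "y \<in> std_simplex"
  shows "supp ((1/2) *\<^sub>R x + (1/2) *\<^sub>R y) = supp x \<union> supp y"
  using assms unfolding supp_def std_simplex_def by (auto simp: add_nonneg_eq_0_iff)

lemma supp_sets_Un:
  fixes B :: "real^'m^'m"
  assumes "convex (min_set B)" and "J \<in> supp_sets B" and "K \<in> supp_sets B"
  shows "J \<union> K \<in> supp_sets B"
proof -
  obtain x y where x: "x \<in> min_set B" "J = supp x" and y: "y \<in> min_set B" "K = supp y"
    using assms(2,3) unfolding supp_sets_def by blast
  have "(1/2) *\<^sub>R x + (1/2) *\<^sub>R y \<in> min_set B"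
    using x(1) y(1) by (intro convexD[OF assms(1)]) auto
  moreover have "J \<union> K = supp ((1/2) *\<^sub>R x + (1/2) *\<^sub>R y)"
    using x y supp_midpoint mem_min_set_iff by metis
  ultimately show ?thesis unfolding supp_sets_def by blast
qed

lemma supp_sets_Union:
  fixes B :: "real^'m^'m"
  assumes "convex (min_set B)" and "F \<subseteq> supp_sets B" and "F \<noteq> {}"
  shows "\<Union>F \<in> supp_sets B"
proof -
  have "finite F" by simp
  then show ?thesis using assms(3,2)
    by (induction F rule: finite_ne_induct) (simp_all add: supp_sets_Un[OF assms(1)])
qed

section \<open>The minimisers of a fusion frame matrix\<close>

theorem corollary5p2p4:
  fixes smul :: "'k::rc_field \<Rightarrow> 'h::ab_group_add \<Rightarrow> 'h"
    and bs :: "'h set"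
    and ip :: "'h \<Rightarrow> 'h \<Rightarrow> 'k"
    and n :: nat
    and W :: "'m::finite \<Rightarrow> 'h set"
    and d :: "'m \<Rightarrow> nat"
    and w :: "'m \<Rightarrow> real"
    and B :: "real^'m^'m"
  assumes "fin_dim_hilbert_space smul bs ip"
    and "vector_space.dim smul (UNIV :: 'h set) = n"
    and "\<And>i. module.subspace smul (W i)"
    and "module.span smul (\<Union>i. W i) = UNIV"
    and "\<And>i. vector_space.dim smul (W i) = d i"
    and "\<And>i. d i \<ge> 1"
    and "\<And>i. w i = real (d i) powr (- 1 / 2)"
    and "B = fusion_matrix smul bs ip w W"
  shows "(convex (min_set B) \<and>
          (\<forall>z\<^sub>0\<in>min_set B. min_set B = {z\<^sub>0 + y | y. y \<in> null_space B} \<inter> std_simplex)) \<and>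
         ((\<forall>F. F \<subseteq> supp_sets B \<and> F \<noteq> {} \<longrightarrow> \<Union>F \<in> supp_sets B) \<and>
          \<Union>(supp_sets B) = (\<Union>z\<in>min_set B. supp z) \<and>
          \<Union>(supp_sets B) \<in> supp_sets B \<and>
          (\<exists>z\<^sub>1\<in>min_set B. supp z\<^sub>1 = \<Union>(supp_sets B) \<and> (\<forall>z\<in>min_set B. supp z \<subseteq> supp z\<^sub>1)))"
proof -
  interpret fin_dim_hilbert_space smul bs ip by (rule assms(1))
  have sym: "transpose B = B"
    unfolding assms(8) by (rule fusion_matrix_symmetric[OF assms(3)])
  have psd: "(B *v x) \<bullet> x \<ge> 0" for x
    unfolding assms(8) by (rule fusion_matrix_psd[OF assms(3)])
  have conv: "convex (min_set B)" by (rule convex_min_set[OF sym psd])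
  have affine: "\<forall>z\<^sub>0\<in>min_set B. min_set B = {z\<^sub>0 + y | y. y \<in> null_space B} \<inter> std_simplex"
    using min_set_eq_affine_Int_simplex[OF sym psd] by blast
  have unions: "\<forall>F. F \<subseteq> supp_sets B \<and> F \<noteq> {} \<longrightarrow> \<Union>F \<in> supp_sets B"
    using supp_sets_Union[OF conv] by blast
  have union_eq: "\<Union>(supp_sets B) = (\<Union>z\<in>min_set B. supp z)"
    unfolding supp_sets_def by blast
  have "supp_sets B \<noteq> {}"
    using min_set_nonempty unfolding supp_sets_def by blast
  then have max_in: "\<Union>(supp_sets B) \<in> supp_sets B"
    using unions by blast
  then obtain z\<^sub>1 where z1: "z\<^sub>1 \<in> min_set B" "supp z\<^sub>1 = \<Union>(supp_sets B)"
    unfolding supp_sets_def by auto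
  then have "\<forall>z\<in>min_set B. supp z \<subseteq> supp z\<^sub>1"
    using union_eq by blast
  then show ?thesis
    using conv affine unions union_eq max_in z1 by blast
qed

end
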